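(* For finite skew braces $X$ and $Y$, we have $$L_\infty(X\times Y)=L_\infty(X)\times L_\infty(Y)\qquad\text{and}\qquad \mathfrak{R}_L(X\times Y)=\mathfrak{R}_L(X)\times\mathfrak{R}_L(Y).$$
   Context: A skew (left) brace is a triple $X=(X,+,\cdot)$ such that $(X,+)$ and $(X,\cdot)$ are groups on the same set and $a\cdot(b+c)=a\cdot b-a+a\cdot c$ for all $a,b,c\in X$. Put $\lambda_a(b)=-a+a\cdot b$ and $a*b=\lambda_a(b)-b$; for subsets $S,T$, $S*T$ is the subgroup of $(X,+)$ generated by all $s*t$, $s\in S$, $t\in T$. An ideal of $X$ is a subgroup of $(X,+)$ that is invariant under every $\lambda_a$ and normal in both $(X,+)$ and $(X,\cdot)$. The left series is $X^1=X$, $X^{n+1}=X*X^n$; $X$ is left nilpotent if $X^n=0$ for some $n$; $L_\infty(X)=\bigcap_{n\ge1}X^n$. The left-nilpotent residual $\mathfrak{R}_L(X)$ is the intersection of all ideals $I$ of $X$ such that $X/I$ is left nilpotent. $X\times Y$ is the direct product with componentwise operations. *)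

theory Defs
  imports "HOL-Algebra.Generated_Groups" "HOL-Algebra.Chinese_Remainder"
begin

text \<open>
  The two operations of a skew brace live in the record type of HOL-Algebra rings: \<open>\<oplus>\<close> is the
  (possibly noncommutative) additive group operation, \<open>\<otimes>\<close> the multiplicative one. The record has
  separate fields for \<open>\<zero>\<close> and \<open>\<one>\<close>; the compatibility law with \<open>a = \<one>\<close> forces them to be equal.
  The direct product of skew braces is the library's componentwise product \<open>RDirProd\<close>.
\<close>

locale skew_brace =
  fixes X :: "('a, 'm) ring_scheme" (structure)
  assumes add_group: "group (add_monoid X)"
    and mult_group: "group X"
    and brace_law: "\<lbrakk>a \<in> carrier X; b \<in> carrier X; c \<in> carrier X\<rbrakk> \<Longrightarrow>
      a \<otimes> (b \<oplus> c) = (a \<otimes> b \<ominus> a) \<oplus> a \<otimes> c"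

definition brace_lambda :: "('a, 'm) ring_scheme \<Rightarrow> 'a \<Rightarrow> 'a \<Rightarrow> 'a" where
  "brace_lambda X a b = (\<ominus>\<^bsub>X\<^esub> a) \<oplus>\<^bsub>X\<^esub> (a \<otimes>\<^bsub>X\<^esub> b)"

definition brace_star :: "('a, 'm) ring_scheme \<Rightarrow> 'a \<Rightarrow> 'a \<Rightarrow> 'a" where
  "brace_star X a b = brace_lambda X a b \<ominus>\<^bsub>X\<^esub> b"

definition brace_star_set :: "('a, 'm) ring_scheme \<Rightarrow> 'a set \<Rightarrow> 'a set \<Rightarrow> 'a set" where
  "brace_star_set X S T = generate (add_monoid X) {brace_star X s t | s t. s \<in> S \<and> t \<in> T}"

definition brace_ideal :: "'a set \<Rightarrow> ('a, 'm) ring_scheme \<Rightarrow> bool" where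
  "brace_ideal I X \<longleftrightarrow>
     subgroup I (add_monoid X) \<and>
     (\<forall>a \<in> carrier X. brace_lambda X a ` I \<subseteq> I) \<and>
     I \<lhd> add_monoid X \<and> I \<lhd> X"

text \<open>Indexed from 1 as usual; the value at index 0 is a dummy.\<close>

fun left_series :: "('a, 'm) ring_scheme \<Rightarrow> nat \<Rightarrow> 'a set" where
  "left_series X 0 = carrier X"
| "left_series X (Suc 0) = carrier X"
| "left_series X (Suc (Suc n)) = brace_star_set X (carrier X) (left_series X (Suc n))"

definition left_nilpotent :: "('a, 'm) ring_scheme \<Rightarrow> bool" where
  "left_nilpotent X \<longleftrightarrow> (\<exists>n\<ge>1. left_series X n = {\<zero>\<^bsub>X\<^esub>})"

definition L_infinity :: "('a, 'm) ring_scheme \<Rightarrow> 'a set" where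
  "L_infinity X = (\<Inter>n\<in>{1..}. left_series X n)"

text \<open>
  \<open>X Quot I\<close> is the library's quotient record, here used for the quotient skew brace: its carrier
  consists of the additive cosets of \<open>I\<close>, which for an ideal \<open>I\<close> of a skew brace are also the
  multiplicative ones, and the product of the cosets of \<open>a\<close> and \<open>b\<close> is the coset of \<open>a \<otimes> b\<close>.
  The family intersected below contains \<open>carrier X\<close>, so it is never empty for a skew brace \<open>X\<close>.
\<close>

definition left_nilpotent_residual :: "('a, 'm) ring_scheme \<Rightarrow> 'a set" where
  "left_nilpotent_residual X = \<Inter>{I. brace_ideal I X \<and> left_nilpotent (X Quot I)}"

end

theory Submission
  imports Defs
begin

text \<open>
  Both \<open>L_infinity\<close> and \<open>left_nilpotent_residual\<close> are functorial: a homomorphism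
  \<open>h\<close> from \<open>X\<close> to \<open>Z\<close> maps each term of the left series of \<open>X\<close> into the same term for \<open>Z\<close>, and
  the preimage of an ideal with left nilpotent quotient is again such an ideal. For the latter,
  \<open>left_nilpotent_Quot_iff\<close> replaces nilpotency of \<open>X Quot I\<close> by the condition that \<open>I\<close> contains
  some term of the left series of \<open>X\<close>, which visibly passes to preimages.

  Functoriality settles the product formula for any such subgroup \<open>F\<close>. The two projections send
  \<open>F (X \<times> Y)\<close> into \<open>F X\<close> and \<open>F Y\<close>, so \<open>F (X \<times> Y) \<subseteq> F X \<times> F Y\<close>. The two embeddings of
  the factors send \<open>F X\<close> and \<open>F Y\<close> into \<open>F (X \<times> Y)\<close>, which, being closed under addition,
  contains every \<open>(x, y) = (x, \<zero>) \<oplus> (\<zero>, y)\<close>. The embeddings are homomorphisms because the two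
  neutral elements of a skew brace coincide.
\<close>

section \<open>Skew braces and the cosets of an ideal\<close>

sublocale skew_brace \<subseteq> add: group "add_monoid X"
  rewrites "carrier (add_monoid X) = carrier X"
    and "mult (add_monoid X) = add X"
    and "one (add_monoid X) = zero X"
    and "m_inv (add_monoid X) = a_inv X"
  by (rule add_group) (auto simp: a_inv_def)

sublocale skew_brace \<subseteq> mult: group X
  by (rule mult_group)

context skew_brace
begin

lemma lambda_closed [simp]:
  "\<lbrakk>a \<in> carrier X; b \<in> carrier X\<rbrakk> \<Longrightarrow> brace_lambda X a b \<in> carrier X"
  by (simp add: brace_lambda_def)

lemma star_closed [simp]:
  "\<lbrakk>a \<in> carrier X; b \<in> carrier X\<rbrakk> \<Longrightarrow> brace_star X a b \<in> carrier X"
  by (simp add: brace_star_def a_minus_def)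

lemma mult_eq_add_lambda:
  "\<lbrakk>a \<in> carrier X; b \<in> carrier X\<rbrakk> \<Longrightarrow> a \<otimes> b = a \<oplus> brace_lambda X a b"
  by (simp add: brace_lambda_def add.m_assoc [symmetric])

text \<open>The compatibility law with \<open>a = \<one>\<close> reads \<open>b \<oplus> c = b \<ominus> \<one> \<oplus> c\<close>.\<close>

lemma zero_eq_one: "\<zero> = \<one>"
proof -
  have "\<one> \<otimes> (\<one> \<oplus> \<zero>) = (\<one> \<otimes> \<one> \<ominus> \<one>) \<oplus> \<one> \<otimes> \<zero>"
    by (intro brace_law) auto
  then show ?thesis
    by (simp add: a_minus_def)
qed

text \<open>
  Since \<open>\<lambda>\<close> is an action, \<open>\<lambda>\<^bsub>inv a\<^esub>\<close> inverts \<open>\<lambda>\<^bsub>a\<^esub>\<close>; this is the form in which that is needed to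
  rewrite sums as products.
\<close>

lemma add_eq_mult_lambda:
  assumes a: "a \<in> carrier X" and b: "b \<in> carrier X"
  shows "a \<oplus> b = a \<otimes> brace_lambda X (inv a) b"
proof -
  \<comment> \<open>Multiplying \<open>inv a \<oplus> \<ominus> (inv a) = \<zero>\<close> by \<open>a\<close> evaluates the product of \<open>a\<close> and \<open>\<ominus> (inv a)\<close>.\<close>
  have "a \<otimes> (inv a \<oplus> \<ominus> (inv a)) = (a \<otimes> inv a \<ominus> a) \<oplus> a \<otimes> (\<ominus> (inv a))"
    using a by (intro brace_law) auto
  moreover have "a \<otimes> \<zero> = a"
    using a by (simp add: zero_eq_one)
  ultimately have "\<ominus> a \<oplus> a \<otimes> (\<ominus> (inv a)) = a"
    using a by (simp add: a_minus_def zero_eq_one [symmetric])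
  then have *: "a \<otimes> (\<ominus> (inv a)) = a \<oplus> a"
    using a add.inv_solve_left [of a a "a \<otimes> (\<ominus> (inv a))"] by simp
  have "a \<otimes> brace_lambda X (inv a) b = (a \<otimes> (\<ominus> (inv a)) \<ominus> a) \<oplus> a \<otimes> (inv a \<otimes> b)"
    unfolding brace_lambda_def using a b by (intro brace_law) auto
  also have "\<dots> = a \<oplus> b"
    using a b by (simp add: * a_minus_def add.m_assoc mult.m_assoc [symmetric])
  finally show ?thesis ..
qed

lemma ideal_carrier: "brace_ideal (carrier X) X"
  unfolding brace_ideal_def
  using add.normal_self mult.normal_self add.subgroup_self
  by auto

text \<open>
  An element of the additive coset of \<open>x\<close> is \<open>x \<oplus> i = x \<otimes> \<lambda>\<^bsub>inv x\<^esub>(i)\<close> with \<open>i \<in> I\<close>, and one of the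
  multiplicative coset is \<open>x \<otimes> k = x \<oplus> \<lambda>\<^bsub>x\<^esub>(k)\<close> with \<open>k \<in> I\<close>; both normality assumptions serve to pass
  between left and right cosets.
\<close>

lemma add_coset_eq_mult_coset:
  assumes I: "brace_ideal I X" and x: "x \<in> carrier X"
  shows "I +> x = I #> x"
proof -
  have lam: "brace_lambda X a i \<in> I" if "a \<in> carrier X" "i \<in> I" for a i
    using I that by (auto simp: brace_ideal_def)
  have sub: "I \<subseteq> carrier X"
    using I subgroup.subset [of I X] by (simp add: brace_ideal_def normal_imp_subgroup)
  have "I +> x = {x \<oplus> i | i. i \<in> I}"
    using normal.coset_eq [of I "add_monoid X"] I x
    by (auto simp: brace_ideal_def a_r_coset_def l_coset_def)
  also have "\<dots> = {x \<otimes> k | k. k \<in> I}"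
  proof (intro subset_antisym subsetI)
    fix y assume "y \<in> {x \<oplus> i | i. i \<in> I}"
    then obtain i where "i \<in> I" "y = x \<otimes> brace_lambda X (inv x) i"
      using add_eq_mult_lambda x sub by blast
    then show "y \<in> {x \<otimes> k | k. k \<in> I}"
      using lam x by blast
  next
    fix y assume "y \<in> {x \<otimes> k | k. k \<in> I}"
    then obtain k where "k \<in> I" "y = x \<oplus> brace_lambda X x k"
      using mult_eq_add_lambda x sub by blast
    then show "y \<in> {x \<oplus> i | i. i \<in> I}"
      using lam x by blast
  qed
  also have "\<dots> = I #> x"
    using normal.coset_eq [of I X] I x by (auto simp: brace_ideal_def l_coset_def)
  finally show ?thesis .
qed

text \<open>
  The product in \<open>X Quot I\<close> is a union of additive cosets \<open>I +> a \<otimes> b\<close> over all representatives;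
  these agree because the cosets are also those of a normal subgroup of the multiplicative group.
\<close>

lemma coset_map_ring_hom:
  assumes I: "brace_ideal I X"
  shows "(+>) I \<in> ring_hom X (X Quot I)"
proof (rule ring_hom_memI)
  have nadd: "I \<lhd> add_monoid X" and nmult: "I \<lhd> X"
    using I by (auto simp: brace_ideal_def)
  note coset = add_coset_eq_mult_coset [OF I]
  fix x y assume x: "x \<in> carrier X" and y: "y \<in> carrier X"
  show "I +> x \<in> carrier (X Quot I)"
    using x by (auto simp: FactRing_def A_RCOSETS_def')
  show "I +> (x \<oplus> y) = (I +> x) \<oplus>\<^bsub>X Quot I\<^esub> (I +> y)"
    using normal.rcos_sum [OF nadd] x y
    by (simp add: FactRing_def a_r_coset_def set_add_def)
  have "I +> (a \<otimes> b) = I +> (x \<otimes> y)" if "a \<in> I +> x" "b \<in> I +> y" for a b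
  proof -
    have sub: "subgroup I X" using nmult normal_imp_subgroup by blast
    have "I \<subseteq> carrier X" using subgroup.subset [OF sub] .
    have ab: "a \<in> I #> x" "b \<in> I #> y" using that coset x y by auto
    then have c: "a \<in> carrier X" "b \<in> carrier X"
      using mult.r_coset_subset_G \<open>I \<subseteq> carrier X\<close> x y by blast+
    have "a \<otimes> b \<in> (I #> x) <#> (I #> y)"
      using ab by (auto simp: set_mult_def)
    then have "a \<otimes> b \<in> I #> (x \<otimes> y)"
      using normal.rcos_sum [OF nmult x y] by simp
    then have "I #> (x \<otimes> y) = I #> (a \<otimes> b)"
      using mult.repr_independence [OF _ _ sub] x y by blast
    then show ?thesis
      using coset x y c by simp
  qed
  moreover have "x \<in> I +> x" "y \<in> I +> y"
    using add.rcos_self [of _ I] nadd normal_imp_subgroup x y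
    by (auto simp: a_r_coset_def)
  ultimately have "(\<Union>a\<in>I +> x. \<Union>b\<in>I +> y. I +> (a \<otimes> b)) = I +> (x \<otimes> y)"
    by blast
  then show "I +> (x \<otimes> y) = (I +> x) \<otimes>\<^bsub>X Quot I\<^esub> (I +> y)"
    by (simp add: FactRing_def rcoset_mult_def)
next
  show "I +> \<one> = \<one>\<^bsub>X Quot I\<^esub>"
    by (simp add: FactRing_def)
qed

lemma coset_map_surj: "(+>) I ` carrier X = carrier (X Quot I)"
  by (auto simp: FactRing_def A_RCOSETS_def')

lemma Quot_add_group:
  assumes "brace_ideal I X"
  shows "group (add_monoid (X Quot I))"
proof -
  have "add_monoid (X Quot I) = add_monoid X Mod I"
    by (simp add: FactRing_def FactGroup_def A_RCOSETS_def set_add_def)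
  then show ?thesis
    using assms normal.factorgroup_is_group by (auto simp: brace_ideal_def)
qed

section \<open>The left series\<close>

lemma left_series_subgroup: "subgroup (left_series X n) (add_monoid X)"
proof (induction n)
  case 0
  show ?case using add.subgroup_self by simp
next
  case (Suc n)
  show ?case
  proof (cases n)
    case 0
    then show ?thesis using add.subgroup_self by simp
  next
    case (Suc m)
    have "{brace_star X s t | s t. s \<in> carrier X \<and> t \<in> left_series X n} \<subseteq> carrier X"
      using subgroup.subset [OF Suc.IH] by auto
    then show ?thesis
      using add.generate_is_subgroup by (simp add: Suc brace_star_set_def)
  qed
qed

lemma left_series_subset: "left_series X n \<subseteq> carrier X"
  using subgroup.subset [OF left_series_subgroup] by simp

end

text \<open>
  The target is only required to be a group under addition, so that the coset map onto \<open>X Quot I\<close>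
  is an instance without first verifying the skew brace laws in the quotient.
\<close>

locale brace_hom = skew_brace X for X :: "('a, 'm) ring_scheme" (structure) +
  fixes Z :: "('b, 'n) ring_scheme" and h
  assumes target_group: "group (add_monoid Z)"
    and hom: "h \<in> ring_hom X Z"

sublocale brace_hom \<subseteq> addh: group_hom "add_monoid X" "add_monoid Z" h
proof (intro group_hom.intro group_hom_axioms.intro add_group target_group)
  show "h \<in> Group.hom (add_monoid X) (add_monoid Z)"
    using hom by (auto simp: ring_hom_def Group.hom_def)
qed

context brace_hom
begin

lemma hom_closed: "a \<in> carrier X \<Longrightarrow> h a \<in> carrier Z"
  using hom by (auto simp: ring_hom_def)

lemma hom_neg: "a \<in> carrier X \<Longrightarrow> h (\<ominus> a) = \<ominus>\<^bsub>Z\<^esub> h a"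
  using addh.hom_inv [of a] by (simp add: a_inv_def)

lemma hom_lambda:
  assumes "a \<in> carrier X" "b \<in> carrier X"
  shows "h (brace_lambda X a b) = brace_lambda Z (h a) (h b)"
  using assms
  by (simp add: brace_lambda_def ring_hom_add [OF hom] ring_hom_mult [OF hom] hom_neg)

lemma hom_star:
  assumes "a \<in> carrier X" "b \<in> carrier X"
  shows "h (brace_star X a b) = brace_star Z (h a) (h b)"
  using assms
  by (simp add: brace_star_def a_minus_def ring_hom_add [OF hom] hom_lambda hom_neg)

lemma hom_star_set:
  assumes S: "S \<subseteq> carrier X" and T: "T \<subseteq> carrier X"
  shows "h ` brace_star_set X S T = brace_star_set Z (h ` S) (h ` T)"
proof -
  let ?K = "{brace_star X s t | s t. s \<in> S \<and> t \<in> T}"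
  have "h ` ?K = {brace_star Z s t | s t. s \<in> h ` S \<and> t \<in> h ` T}"
    using S T by (fastforce simp: hom_star image_iff)
  moreover have "?K \<subseteq> carrier (add_monoid X)"
    using S T by (auto intro!: star_closed)
  ultimately show ?thesis
    using addh.generate_img [of ?K] by (simp add: brace_star_set_def)
qed

lemma left_series_hom: "h ` left_series X n \<subseteq> left_series Z n"
proof (induction n)
  case 0
  show ?case using hom by (auto simp: ring_hom_def)
next
  case (Suc n)
  show ?case
  proof (cases n)
    case 0
    then show ?thesis using hom by (auto simp: ring_hom_def)
  next
    case (Suc m)
    have "brace_star_set Z (h ` carrier X) (h ` left_series X n)
        \<subseteq> brace_star_set Z (carrier Z) (left_series Z n)"
      unfolding brace_star_set_def using hom Suc.IH
      by (intro group.mono_generate [OF target_group]) (auto simp: ring_hom_def)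
    then show ?thesis
      using hom_star_set left_series_subset by (simp add: Suc)
  qed
qed

lemma left_series_surj_hom:
  assumes surj: "h ` carrier X = carrier Z"
  shows "h ` left_series X n = left_series Z n"
proof (induction n)
  case 0
  show ?case using surj by simp
next
  case (Suc n)
  then show ?case
    using surj hom_star_set left_series_subset by (cases n) auto
qed

end

text \<open>
  The coset map sends the left series of \<open>X\<close> onto that of \<open>X Quot I\<close>, and sends a nonempty set to
  the zero coset alone exactly if that set lies in \<open>I\<close>.
\<close>

lemma (in skew_brace) left_nilpotent_Quot_iff:
  assumes I: "brace_ideal I X"
  shows "left_nilpotent (X Quot I) \<longleftrightarrow> (\<exists>n\<ge>1. left_series X n \<subseteq> I)"
proof -
  interpret brace_hom X "X Quot I" "(+>) I"
    by (intro brace_hom.intro brace_hom_axioms.intro skew_brace_axioms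
        Quot_add_group coset_map_ring_hom I)
  have I_sub: "subgroup I (add_monoid X)"
    using I by (simp add: brace_ideal_def)
  have mem: "I +> x = I \<longleftrightarrow> x \<in> I" if "x \<in> carrier X" for x
    using add.coset_join1 [of I x] add.coset_join2 [of x I] I_sub that
      subgroup.subset [OF I_sub]
    by (auto simp: a_r_coset_def)
  have "left_series (X Quot I) n = {I} \<longleftrightarrow> left_series X n \<subseteq> I" for n
  proof -
    have "left_series (X Quot I) n = {I} \<longleftrightarrow> (+>) I ` left_series X n = {I}"
      using left_series_surj_hom [OF coset_map_surj] by simp
    also have "\<dots> \<longleftrightarrow> (\<forall>x \<in> left_series X n. I +> x = I)"
      using subgroup.one_closed [OF left_series_subgroup [of n]] by auto
    also have "\<dots> \<longleftrightarrow> left_series X n \<subseteq> I"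
      using mem left_series_subset by blast
    finally show ?thesis .
  qed
  moreover have "\<zero>\<^bsub>X Quot I\<^esub> = I"
    by (simp add: FactRing_def)
  ultimately show ?thesis
    unfolding left_nilpotent_def by simp
qed

section \<open>Functoriality of the two residuals\<close>

lemma (in group_hom) normal_vimage:
  assumes J: "J \<lhd> H"
  shows "{x \<in> carrier G. h x \<in> J} \<lhd> G"
proof -
  interpret J: normal J H by (rule J)
  show ?thesis
  proof (rule G.normal_invI)
    show "subgroup {x \<in> carrier G. h x \<in> J} G"
      by (rule subgroup.intro) auto
  qed (simp add: J.inv_op_closed2)
qed

lemma (in brace_hom) ideal_vimage:
  assumes Z: "group Z" and J: "brace_ideal J Z"
  shows "brace_ideal {x \<in> carrier X. h x \<in> J} X"
proof -
  interpret multh: group_hom X Z h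
  proof (intro group_hom.intro group_hom_axioms.intro mult_group Z)
    show "h \<in> Group.hom X Z"
      using hom by (auto simp: ring_hom_def Group.hom_def)
  qed
  have "{x \<in> carrier X. h x \<in> J} \<lhd> add_monoid X"
    using addh.normal_vimage J by (simp add: brace_ideal_def)
  moreover have "{x \<in> carrier X. h x \<in> J} \<lhd> X"
    using multh.normal_vimage J by (simp add: brace_ideal_def)
  moreover have "brace_lambda X a x \<in> {x \<in> carrier X. h x \<in> J}"
    if "a \<in> carrier X" "x \<in> carrier X" "h x \<in> J" for a x
  proof -
    have "brace_lambda Z (h a) ` J \<subseteq> J"
      using J hom_closed that by (simp add: brace_ideal_def)
    then show ?thesis
      using that by (auto simp: hom_lambda)
  qed
  ultimately show ?thesis
    unfolding brace_ideal_def by (simp add: normal_imp_subgroup image_subset_iff)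
qed

lemma (in brace_hom) L_infinity_hom: "h ` L_infinity X \<subseteq> L_infinity Z"
  unfolding L_infinity_def using left_series_hom by blast

lemma (in brace_hom) left_nilpotent_residual_hom:
  assumes Z: "skew_brace Z"
  shows "h ` left_nilpotent_residual X \<subseteq> left_nilpotent_residual Z"
proof -
  interpret Z: skew_brace Z by (rule Z)
  have "h x \<in> J"
    if x: "x \<in> left_nilpotent_residual X" and J: "brace_ideal J Z" "left_nilpotent (Z Quot J)"
    for x J
  proof -
    let ?I = "{x \<in> carrier X. h x \<in> J}"
    have I: "brace_ideal ?I X"
      using ideal_vimage J Z.mult_group by blast
    obtain n where "n \<ge> 1" "left_series Z n \<subseteq> J"
      using Z.left_nilpotent_Quot_iff J by blast
    then have "left_series X n \<subseteq> ?I"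
      using left_series_hom left_series_subset by blast
    then have "left_nilpotent (X Quot ?I)"
      using left_nilpotent_Quot_iff [OF I] \<open>n \<ge> 1\<close> by blast
    then have "x \<in> ?I"
      using x I unfolding left_nilpotent_residual_def by blast
    then show ?thesis by simp
  qed
  then show ?thesis
    by (auto simp: left_nilpotent_residual_def)
qed

lemma (in skew_brace) L_infinity_subgroup: "subgroup (L_infinity X) (add_monoid X)"
  unfolding L_infinity_def
proof (rule add.subgroups_Inter)
  show "subgroup H (add_monoid X)" if "H \<in> left_series X ` {1..}" for H
    using that left_series_subgroup by blast
qed simp

lemma (in skew_brace) left_nilpotent_residual_subgroup:
  "subgroup (left_nilpotent_residual X) (add_monoid X)"
  unfolding left_nilpotent_residual_def
proof (rule add.subgroups_Inter)
  have "left_series X 1 \<subseteq> carrier X" by simp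
  then have "left_nilpotent (X Quot carrier X)"
    using left_nilpotent_Quot_iff [OF ideal_carrier] by blast
  then show "{I. brace_ideal I X \<and> left_nilpotent (X Quot I)} \<noteq> {}"
    using ideal_carrier by blast
qed (simp add: brace_ideal_def)

section \<open>Direct products\<close>

lemma RDirProd_simps:
  "carrier (RDirProd X Y) = carrier X \<times> carrier Y"
  "(a, b) \<otimes>\<^bsub>RDirProd X Y\<^esub> (c, d) = (a \<otimes>\<^bsub>X\<^esub> c, b \<otimes>\<^bsub>Y\<^esub> d)"
  "(a, b) \<oplus>\<^bsub>RDirProd X Y\<^esub> (c, d) = (a \<oplus>\<^bsub>X\<^esub> c, b \<oplus>\<^bsub>Y\<^esub> d)"
  "\<one>\<^bsub>RDirProd X Y\<^esub> = (\<one>\<^bsub>X\<^esub>, \<one>\<^bsub>Y\<^esub>)"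
  by (simp_all add: RDirProd_def DirProd_def monoid.defs)

lemma RDirProd_skew_brace:
  assumes "skew_brace X" and "skew_brace Y"
  shows "skew_brace (RDirProd X Y)"
proof -
  interpret X: skew_brace X by fact
  interpret Y: skew_brace Y by fact
  have neg: "\<ominus>\<^bsub>RDirProd X Y\<^esub> (a, b) = (\<ominus>\<^bsub>X\<^esub> a, \<ominus>\<^bsub>Y\<^esub> b)"
    if "a \<in> carrier X" "b \<in> carrier Y" for a b
    using that inv_DirProd [OF X.add_group Y.add_group, of a b]
    by (simp only: a_inv_def RDirProd_add_monoid) simp
  show ?thesis
  proof (rule skew_brace.intro)
    show "group (add_monoid (RDirProd X Y))"
      unfolding RDirProd_add_monoid by (rule DirProd_group [OF X.add_group Y.add_group])
    show "group (RDirProd X Y)"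
    proof (rule groupI)
      fix z assume "z \<in> carrier (RDirProd X Y)"
      then show "\<exists>w\<in>carrier (RDirProd X Y). w \<otimes>\<^bsub>RDirProd X Y\<^esub> z = \<one>\<^bsub>RDirProd X Y\<^esub>"
        by (intro bexI [of _ "(inv\<^bsub>X\<^esub> (fst z), inv\<^bsub>Y\<^esub> (snd z))"]) (auto simp: RDirProd_simps)
    qed (auto simp: RDirProd_simps X.mult.m_assoc Y.mult.m_assoc)
  next
    fix a b c
    assume "a \<in> carrier (RDirProd X Y)" "b \<in> carrier (RDirProd X Y)" "c \<in> carrier (RDirProd X Y)"
    then show "a \<otimes>\<^bsub>RDirProd X Y\<^esub> (b \<oplus>\<^bsub>RDirProd X Y\<^esub> c) =
        (a \<otimes>\<^bsub>RDirProd X Y\<^esub> b \<ominus>\<^bsub>RDirProd X Y\<^esub> a) \<oplus>\<^bsub>RDirProd X Y\<^esub> a \<otimes>\<^bsub>RDirProd X Y\<^esub> c"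
      using X.brace_law Y.brace_law
      by (auto simp: RDirProd_simps neg a_minus_def)
  qed
qed

lemma subgroup_RDirProd_eqI:
  assumes X: "skew_brace X" and Y: "skew_brace Y"
    and S: "subgroup S (add_monoid (RDirProd X Y))"
    and A: "A \<subseteq> carrier X" and B: "B \<subseteq> carrier Y"
    and proj: "fst ` S \<subseteq> A" "snd ` S \<subseteq> B"
    and emb: "(\<lambda>x. (x, \<zero>\<^bsub>Y\<^esub>)) ` A \<subseteq> S" "(\<lambda>y. (\<zero>\<^bsub>X\<^esub>, y)) ` B \<subseteq> S"
  shows "S = A \<times> B"
proof (intro subset_antisym subsetI)
  fix z assume "z \<in> S"
  then show "z \<in> A \<times> B" using proj by (cases z) force
next
  interpret X: skew_brace X by fact
  interpret Y: skew_brace Y by fact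
  fix z assume "z \<in> A \<times> B"
  then obtain x y where z: "z = (x, y)" "x \<in> A" "y \<in> B" by blast
  then have "(x, \<zero>\<^bsub>Y\<^esub>) \<oplus>\<^bsub>RDirProd X Y\<^esub> (\<zero>\<^bsub>X\<^esub>, y) \<in> S"
    using subgroup.m_closed [OF S, of "(x, \<zero>\<^bsub>Y\<^esub>)" "(\<zero>\<^bsub>X\<^esub>, y)"] emb by (auto simp: RDirProd_simps)
  moreover have "x \<in> carrier X" "y \<in> carrier Y"
    using z A B by auto
  ultimately show "z \<in> S"
    by (simp add: RDirProd_simps z)
qed

theorem proposition5p6:
  fixes X :: "('a, 'm) ring_scheme" and Y :: "('b, 'n) ring_scheme"
  assumes "skew_brace X" and "finite (carrier X)"
    and "skew_brace Y" and "finite (carrier Y)"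
  shows "L_infinity (RDirProd X Y) = L_infinity X \<times> L_infinity Y
    \<and> left_nilpotent_residual (RDirProd X Y) = left_nilpotent_residual X \<times> left_nilpotent_residual Y"
proof -
  let ?P = "RDirProd X Y"
  interpret X: skew_brace X by fact
  interpret Y: skew_brace Y by fact
  interpret P: skew_brace ?P
    using RDirProd_skew_brace assms by blast
  interpret proj1: brace_hom ?P X fst
    by (intro brace_hom.intro brace_hom_axioms.intro X.add_group
        X.skew_brace_axioms Y.skew_brace_axioms P.skew_brace_axioms) (auto simp: ring_hom_def RDirProd_simps)
  interpret proj2: brace_hom ?P Y snd
    by (intro brace_hom.intro brace_hom_axioms.intro Y.add_group
        X.skew_brace_axioms Y.skew_brace_axioms P.skew_brace_axioms) (auto simp: ring_hom_def RDirProd_simps)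
  interpret emb1: brace_hom X ?P "\<lambda>x. (x, \<zero>\<^bsub>Y\<^esub>)"
    by (intro brace_hom.intro brace_hom_axioms.intro P.add_group
        X.skew_brace_axioms Y.skew_brace_axioms P.skew_brace_axioms) (auto simp: ring_hom_def RDirProd_simps Y.zero_eq_one)
  interpret emb2: brace_hom Y ?P "\<lambda>y. (\<zero>\<^bsub>X\<^esub>, y)"
    by (intro brace_hom.intro brace_hom_axioms.intro P.add_group
        X.skew_brace_axioms Y.skew_brace_axioms P.skew_brace_axioms) (auto simp: ring_hom_def RDirProd_simps X.zero_eq_one)
  note eqI = subgroup_RDirProd_eqI [OF X.skew_brace_axioms Y.skew_brace_axioms]
  show ?thesis
  proof
    show "L_infinity ?P = L_infinity X \<times> L_infinity Y"
      using subgroup.subset [OF X.L_infinity_subgroup] subgroup.subset [OF Y.L_infinity_subgroup]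
      by (intro eqI P.L_infinity_subgroup proj1.L_infinity_hom proj2.L_infinity_hom
          emb1.L_infinity_hom emb2.L_infinity_hom) simp_all
    show "left_nilpotent_residual ?P = left_nilpotent_residual X \<times> left_nilpotent_residual Y"
      using subgroup.subset [OF X.left_nilpotent_residual_subgroup]
        subgroup.subset [OF Y.left_nilpotent_residual_subgroup]
      by (intro eqI P.left_nilpotent_residual_subgroup
          proj1.left_nilpotent_residual_hom proj2.left_nilpotent_residual_hom
          emb1.left_nilpotent_residual_hom emb2.left_nilpotent_residual_hom
          X.skew_brace_axioms Y.skew_brace_axioms P.skew_brace_axioms) simp_all
  qed
qed

end
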